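(* Let $G^{N}$ be a probe graph on $n$ vertices with $|N|=k$ and with the vertices of $N$ ordered last. Let $P$ be the $(n-k)\times n$ pattern matrix corresponding to the probe vertices of $G^{N}$, and let $[A\;\;B]$ be an $(n-k)\times n$ real matrix (with $A$ symmetric of size $(n-k)\times(n-k)$ and $B$ of size $(n-k)\times k$) that realizes the minimum rank of $P$. Then $$\operatorname{mr}(P)=\operatorname{rank}(A)+\operatorname{rank}(B_{A^\perp})\le \operatorname{mr}(G^{N})\le \operatorname{rank}(A)+2\operatorname{rank}(B_{A^\perp}).$$
   Context: Graphs are finite, simple and undirected. For a graph $G$ on vertices $v_1,\dots,v_n$, $\mathcal S(G)$ is the set of real symmetric $n\times n$ matrices whose $ij$ entry, for $i\ne j$, is nonzero if and only if $v_iv_j\in E(G)$; diagonal entries are arbitrary. A probe graph $G^{N}$ is a graph $G$ with an independent set $N\subseteq V(G)$ of non-probe vertices; the other vertices are probe vertices. With the $k=|N|$ vertices of $N$ ordered last, $\mathcal S(G^{N})$ is the set of matrices $A'+\begin{bmatrix}O&O\\O&B'\end{bmatrix}$ with $A'\in\mathcal S(G)$ and $B'$ any real symmetric $k\times k$ matrix; $\operatorname{mr}(G^{N})$ is the minimum rank of a matrix in $\mathcal S(G^{N})$. The pattern matrix $P$ corresponding to the probe vertices is the $(n-k)\times n$ matrix with rows indexed by the probe vertices $v_1,\dots,v_{n-k}$, with entry $P_{ij}=*$ (nonzero) if $v_iv_j\in E(G)$, $P_{ij}=0$ if $i\neq j$ and $v_iv_j\notin E(G)$, and $P_{ij}=\,?$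 (arbitrary) if $i=j$. A real matrix $[A\;\;B]$ has pattern $P$ if its entries are nonzero where $P$ has $*$, zero where $P$ has $0$, and arbitrary where $P$ has $?$. $\operatorname{mr}(P)$ is the minimum rank of a real matrix $[A\;\;B]$ with pattern $P$ and $A$ symmetric; $[A\;\;B]$ realizes the minimum rank of $P$ if it is such a matrix with $\operatorname{rank}[A\;\;B]=\operatorname{mr}(P)$. For matrices $A,B$ with the same number of rows, write $B=B_A+B_{A^\perp}$, where each column of $B_A$ is the orthogonal projection of the corresponding column of $B$ onto the column space of $A$. *)

theory Defs
  imports
    "Graph_Theory.Pair_Digraph"
    "Jordan_Normal_Form.DL_Rank"
begin

section \<open>Real matrices\<close>

definition mat_rank :: "real mat \<Rightarrow> nat" where
  "mat_rank M = vec_space.rank (dim_row M) M"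

definition sym_mat :: "real mat \<Rightarrow> bool" where
  "sym_mat M \<longleftrightarrow> square_mat M \<and> M\<^sup>T = M"

text \<open>The juxtaposition \<open>[A  B]\<close> of two matrices with the same number of rows.\<close>

definition hcat :: "'a::zero mat \<Rightarrow> 'a mat \<Rightarrow> 'a mat" where
  "hcat A B = four_block_mat A B (0\<^sub>m 0 (dim_col A)) (0\<^sub>m 0 (dim_col B))"

text \<open>Orthogonal projection of \<open>b\<close> onto the column space of \<open>A\<close>: the unique vector of the
  column space whose difference from \<open>b\<close> is orthogonal to the column space.\<close>

definition orth_proj :: "real mat \<Rightarrow> real vec \<Rightarrow> real vec" where
  "orth_proj A b = (THE p. p \<in> vec_space.col_space (dim_row A) A \<and>
     (\<forall>y \<in> vec_space.col_space (dim_row A) A. (b - p) \<bullet> y = 0))"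

text \<open>For \<open>A\<close> and \<open>B\<close> with the same number of rows, \<open>B = proj_part A B + perp_part A B\<close> is the
  decomposition \<open>B = B_A + B_(A perp)\<close>.\<close>

definition proj_part :: "real mat \<Rightarrow> real mat \<Rightarrow> real mat" where
  "proj_part A B = mat_of_cols (dim_row A) (map (orth_proj A) (cols B))"

definition perp_part :: "real mat \<Rightarrow> real mat \<Rightarrow> real mat" where
  "perp_part A B = B - proj_part A B"

section \<open>Probe graphs\<close>

text \<open>A finite simple undirected graph is a \<^locale>\<open>pair_graph\<close>: a finite loop-free digraph without
  parallel arcs and with a symmetric arc set.\<close>

definition independent_set :: "'v pair_pre_digraph \<Rightarrow> 'v set \<Rightarrow> bool" where
  "independent_set G N \<longleftrightarrow> N \<subseteq> pverts G \<and> (\<forall>u\<in>N. \<forall>v\<in>N. (u, v) \<notin> parcs G)"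

definition probe_graph :: "'v pair_pre_digraph \<Rightarrow> 'v set \<Rightarrow> bool" where
  "probe_graph G N \<longleftrightarrow> pair_graph G \<and> independent_set G N"

text \<open>\<open>vs\<close> lists the vertices of \<open>G\<close>, those of \<open>N\<close> last; the vertex \<open>v_(i+1)\<close> is \<open>vs ! i\<close>.\<close>

definition probe_ordering :: "'v pair_pre_digraph \<Rightarrow> 'v set \<Rightarrow> 'v list \<Rightarrow> bool" where
  "probe_ordering G N vs \<longleftrightarrow>
     distinct vs \<and> set vs = pverts G \<and> set (drop (length vs - card N) vs) = N"

definition graph_mats :: "'v pair_pre_digraph \<Rightarrow> 'v list \<Rightarrow> real mat set" where
  "graph_mats G vs = {M \<in> carrier_mat (length vs) (length vs). sym_mat M \<and>
     (\<forall>i < length vs. \<forall>j < length vs. i \<noteq> j \<longrightarrow>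
        (M $$ (i, j) \<noteq> 0 \<longleftrightarrow> (vs ! i, vs ! j) \<in> parcs G))}"

definition probe_mats :: "'v pair_pre_digraph \<Rightarrow> 'v set \<Rightarrow> 'v list \<Rightarrow> real mat set" where
  "probe_mats G N vs = (let k = card N; m = length vs - k in
     {A' + four_block_mat (0\<^sub>m m m) (0\<^sub>m m k) (0\<^sub>m k m) B' | A' B'.
        A' \<in> graph_mats G vs \<and> B' \<in> carrier_mat k k \<and> sym_mat B'})"

definition mr_probe :: "'v pair_pre_digraph \<Rightarrow> 'v set \<Rightarrow> 'v list \<Rightarrow> nat" where
  "mr_probe G N vs = (LEAST r. \<exists>M \<in> probe_mats G N vs. mat_rank M = r)"

section \<open>Pattern matrices\<close>

datatype pattern_entry = Star | Zero | Arbitrary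

fun matches :: "pattern_entry \<Rightarrow> real \<Rightarrow> bool" where
  "matches Star x \<longleftrightarrow> x \<noteq> 0"
| "matches Zero x \<longleftrightarrow> x = 0"
| "matches Arbitrary x \<longleftrightarrow> True"

definition has_pattern :: "real mat \<Rightarrow> pattern_entry mat \<Rightarrow> bool" where
  "has_pattern M P \<longleftrightarrow> M \<in> carrier_mat (dim_row P) (dim_col P) \<and>
     (\<forall>i < dim_row P. \<forall>j < dim_col P. matches (P $$ (i, j)) (M $$ (i, j)))"

definition probe_pattern :: "'v pair_pre_digraph \<Rightarrow> 'v set \<Rightarrow> 'v list \<Rightarrow> pattern_entry mat" where
  "probe_pattern G N vs = mat (length vs - card N) (length vs)
     (\<lambda>(i, j). if i = j then Arbitrary
               else if (vs ! i, vs ! j) \<in> parcs G then Star else Zero)"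

text \<open>The matrices \<open>[A  B]\<close> over which the minimum rank of \<open>P\<close> is taken; \<open>P\<close> has at least as many
  columns as rows.\<close>

definition pattern_matrix_pair :: "pattern_entry mat \<Rightarrow> real mat \<Rightarrow> real mat \<Rightarrow> bool" where
  "pattern_matrix_pair P A B \<longleftrightarrow>
     A \<in> carrier_mat (dim_row P) (dim_row P) \<and> sym_mat A \<and>
     B \<in> carrier_mat (dim_row P) (dim_col P - dim_row P) \<and>
     has_pattern (hcat A B) P"

definition mr_pattern :: "pattern_entry mat \<Rightarrow> nat" where
  "mr_pattern P = (LEAST r. \<exists>A B. pattern_matrix_pair P A B \<and> mat_rank (hcat A B) = r)"

definition realizes_min_rank :: "pattern_entry mat \<Rightarrow> real mat \<Rightarrow> real mat \<Rightarrow> bool" where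
  "realizes_min_rank P A B \<longleftrightarrow>
     pattern_matrix_pair P A B \<and> mat_rank (hcat A B) = mr_pattern P"

end

theory Submission
  imports Defs
begin

text \<open>
  Write \<open>B = A X + Q\<close>, where \<open>A X\<close> is the columnwise orthogonal projection of \<open>B\<close> onto the column
  space of \<open>A\<close>, so that \<open>Q\<^sup>T A = 0\<close> (\<open>projection_decomposition\<close>).

  Column operations with \<open>A\<close> turn \<open>[A  B]\<close> into \<open>[A  Q]\<close>, and the column spaces of \<open>A\<close> and \<open>Q\<close> are
  orthogonal, so their dimensions add: this is the equality (\<open>mat_rank_hcat\<close>).

  For the lower bound, the rows of a matrix of \<open>S(G\<^sup>N)\<close> that belong to probe vertices form a matrix
  \<open>[A\<^sub>0  B\<^sub>0]\<close> with pattern \<open>P\<close> and \<open>A\<^sub>0\<close> symmetric, and deleting rows does not raise the rank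
  (\<open>probe_rows\<close>).

  For the upper bound, the lower right block of a matrix of \<open>S(G\<^sup>N)\<close> is free, and \<open>X\<^sup>T A X\<close> is a good
  choice for it: the matrix with blocks \<open>A\<close>, \<open>B\<close>, \<open>B\<^sup>T\<close>, \<open>X\<^sup>T A X\<close> is the sum of
  \<open>[I  X]\<^sup>T A [I  X]\<close>, of rank at most \<open>rank A\<close>, and of the matrix with off-diagonal blocks \<open>Q\<close> and
  \<open>Q\<^sup>T\<close>, of rank at most \<open>2 rank Q\<close> (\<open>mat_rank_symmetric_completion_le\<close>).

  The main tool is the full-rank factorization \<open>M = X Y\<close>, where \<open>X\<close> has trivial kernel
  (\<open>rank_factorization\<close>). It gives the invariance of the rank under transposition and bases of the
  column spaces of \<open>A\<close> and \<open>Q\<close> in matrix form. It also yields the existence of orthogonal projections: a matrix \<open>U\<close> with trivial kernel has an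
  invertible Gram matrix \<open>U\<^sup>T U\<close>, so the normal equations can be solved.
\<close>

section \<open>Rank of real matrices\<close>

lemma real_scalar_prod_self_eq_0:
  fixes v :: "real vec"
  assumes "v \<in> carrier_vec d" and "v \<bullet> v = 0"
  shows "v = 0\<^sub>v d"
proof (rule eq_vecI)
  have "(\<Sum>i<d. v $ i * v $ i) = 0"
    using assms by (auto simp: scalar_prod_def atLeast0LessThan)
  then have "\<forall>i\<in>{..<d}. v $ i * v $ i = 0"
    by (subst (asm) sum_nonneg_eq_0_iff) auto
  then show "v $ i = 0\<^sub>v d $ i" if "i < dim_vec (0\<^sub>v d)" for i using that by auto
qed (use assms in auto)

lemma mat_rank_eq: "M \<in> carrier_mat d c \<Longrightarrow> mat_rank M = vec_space.rank d M"
  by (simp add: mat_rank_def)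

lemma col_space_iff:
  fixes A :: "real mat"
  assumes "A \<in> carrier_mat d c"
  shows "y \<in> vec_space.col_space d A \<longleftrightarrow> (\<exists>x\<in>carrier_vec c. y = A *\<^sub>v x)"
proof -
  interpret vec_space "TYPE(real)" d .
  show ?thesis using assms col_space_eq[OF assms] by auto
qed

lemma mult_mat_unit_vec:
  fixes A :: "real mat"
  assumes "A \<in> carrier_mat d c" and "j < c"
  shows "A *\<^sub>v unit_vec c j = col A j"
  by (rule eq_vecI) (use assms in auto)

lemma mult_left_factor_if_cols:
  fixes M X :: "real mat"
  assumes M: "M \<in> carrier_mat d c" and X: "X \<in> carrier_mat d r"
    and "\<And>j. j < c \<Longrightarrow> col M j \<in> vec_space.col_space d X"
  obtains Y where "Y \<in> carrier_mat r c" and "M = X * Y"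
proof -
  have "\<forall>j\<in>{..<c}. \<exists>y. y \<in> carrier_vec r \<and> col M j = X *\<^sub>v y"
    using assms(3) col_space_iff[OF X] by auto
  then obtain y where y: "\<And>j. j < c \<Longrightarrow> y j \<in> carrier_vec r \<and> col M j = X *\<^sub>v y j"
    by (metis lessThan_iff)
  define Y where "Y = mat_of_cols r (map y [0..<c])"
  have Y: "Y \<in> carrier_mat r c" by (auto simp: Y_def)
  have "col (X * Y) j = col M j" if "j < c" for j
    using that X Y y by (auto simp: Y_def col_mult2[OF X Y] col_mat_of_cols)
  then have "M = X * Y" by (intro mat_col_eqI) (use M X Y in auto)
  with Y show thesis by (rule that)
qed

text \<open>A repeated column or a linear dependence between the columns would give a nonzero kernel vector, so
  the columns form a basis of the column space.\<close>

lemma mat_rank_of_trivial_kernel: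
  fixes X :: "real mat"
  assumes X: "X \<in> carrier_mat d r"
    and ker: "\<And>v. v \<in> carrier_vec r \<Longrightarrow> X *\<^sub>v v = 0\<^sub>v d \<Longrightarrow> v = 0\<^sub>v r"
  shows "mat_rank X = r"
proof -
  interpret vec_space "TYPE(real)" d .
  have dist: "distinct (cols X)"
  proof (rule ccontr)
    assume "\<not> distinct (cols X)"
    then obtain i j where ij: "i < r" "j < r" "i \<noteq> j" "col X i = col X j"
      using X by (auto simp: distinct_conv_nth)
    let ?v = "unit_vec r i - unit_vec r j :: real vec"
    have "X *\<^sub>v ?v = X *\<^sub>v unit_vec r i - X *\<^sub>v unit_vec r j"
      by (rule mult_minus_distrib_mat_vec[OF X]) auto
    also have "\<dots> = 0\<^sub>v d"
      using ij X by (auto simp: mult_mat_unit_vec[OF X] intro!: eq_vecI)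
    finally have "?v = 0\<^sub>v r" by (intro ker) auto
    then have "?v $ i = 0" using ij by simp
    then show False using ij by simp
  qed
  have "lin_indpt (set (cols X))"
    using lin_depE[OF X _ dist] ker by metis
  then show ?thesis
    using lin_indpt_full_rank[OF X dist] X by (simp add: mat_rank_eq)
qed

text \<open>The columns of \<open>X\<close> are a maximal independent set of columns of \<open>M\<close>. The matrix \<open>Z\<close> selects these
  columns; with it, \<open>X\<close> and \<open>M\<close> have the same column space, and facts about \<open>M\<close> can be read off from
  a matrix with trivial kernel.\<close>

lemma rank_factorization:
  fixes M :: "real mat"
  assumes M: "M \<in> carrier_mat d c"
  obtains X Y Z where "X \<in> carrier_mat d (mat_rank M)" and "Y \<in> carrier_mat (mat_rank M) c"
    and "Z \<in> carrier_mat c (mat_rank M)" and "M = X * Y" and "X = M * Z"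
    and "\<And>v. v \<in> carrier_vec (mat_rank M) \<Longrightarrow> X *\<^sub>v v = 0\<^sub>v d \<Longrightarrow> v = 0\<^sub>v (mat_rank M)"
proof -
  interpret vec_space "TYPE(real)" d .
  have Mc: "set (cols M) \<subseteq> carrier_vec d" using M cols_dim by blast
  let ?P = "\<lambda>T. T \<subseteq> set (cols M) \<and> lin_indpt T"
  obtain S where S: "maximal S ?P"
    using maximal_exists_superset[of "set (cols M)" ?P "{}"] by (auto simp: lin_dep_def)
  then have SP: "S \<subseteq> set (cols M)" "lin_indpt S" by (auto simp: maximal_def)
  have rS: "mat_rank M = card S" using rank_card_indpt[OF M S] M by (simp add: mat_rank_eq)
  have fS: "finite S" using SP finite_subset by blast
  have Sc: "S \<subseteq> carrier_vec d" using SP Mc by auto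
  obtain xs where xs: "set xs = S" "distinct xs" using fS finite_distinct_list by blast
  have len: "length xs = mat_rank M" using xs rS distinct_card by metis
  define X where "X = mat_of_cols d xs"
  have X: "X \<in> carrier_mat d (mat_rank M)" by (auto simp: X_def len)
  have cX: "cols X = xs" unfolding X_def by (rule cols_mat_of_cols) (use xs Sc in auto)
  have ker: "v = 0\<^sub>v (mat_rank M)" if "v \<in> carrier_vec (mat_rank M)" "X *\<^sub>v v = 0\<^sub>v d" for v
    using lin_depI[OF X that(1) _ that(2)] xs cX SP by auto
  have "col M j \<in> col_space X" if j: "j < c" for j
  proof (rule ccontr)
    assume "col M j \<notin> col_space X"
    then have n: "col M j \<notin> span S" by (simp add: col_space_def cX xs)
    have m: "col M j \<in> set (cols M)" using j M by (auto simp: cols_def)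
    have nS: "col M j \<notin> S" using n Sc in_own_span by blast
    have "lin_indpt (S \<union> {col M j})"
      using lin_dep_iff_in_span[OF Sc SP(2) _ nS] n m Mc by auto
    then have "?P (S \<union> {col M j})" using SP m by auto
    then show False using S nS unfolding maximal_def by blast
  qed
  then obtain Y where Y: "Y \<in> carrier_mat (mat_rank M) c" "M = X * Y"
    using mult_left_factor_if_cols[OF M X] by metis
  have "col X j \<in> col_space M" if j: "j < mat_rank M" for j
  proof -
    have "col X j \<in> set (cols X)" using j X by (auto simp: cols_def)
    then have "col X j \<in> set (cols M)" using cX xs SP by auto
    then show ?thesis unfolding col_space_def using in_own_span[OF Mc] by blast
  qed
  then obtain Z where Z: "Z \<in> carrier_mat c (mat_rank M)" "X = M * Z"
    using mult_left_factor_if_cols[OF X M] by metis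
  show thesis using X Y Z ker that by blast
qed

text \<open>The column space of \<open>A * B\<close> is a subspace of that of \<open>A\<close>.\<close>

lemma mat_rank_mult_le_left:
  fixes A B :: "real mat"
  assumes A: "A \<in> carrier_mat d c" and B: "B \<in> carrier_mat c e"
  shows "mat_rank (A * B) \<le> mat_rank A"
proof -
  interpret vec_space "TYPE(real)" d .
  have AB: "A * B \<in> carrier_mat d e" using A B by simp
  have Ac: "set (cols A) \<subseteq> carrier_vec d" using A cols_dim by blast
  have Cc: "set (cols (A * B)) \<subseteq> carrier_vec d" using AB cols_dim by blast
  have "set (cols (A * B)) \<subseteq> span (set (cols A))"
  proof
    fix x assume "x \<in> set (cols (A * B))"
    then obtain j where j: "j < e" "x = col (A * B) j" using AB by (auto simp: cols_def)
    then have "x = A *\<^sub>v col B j" using col_mult2[OF A B] by simp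
    then show "x \<in> span (set (cols A))"
      using j B col_space_iff[OF A, of x] by (auto simp: col_space_def)
  qed
  then have sub: "span (set (cols (A * B))) \<subseteq> span (set (cols A))"
    using span_subsetI[OF Ac] by blast
  interpret W: vectorspace class_ring "span_vs (set (cols A))"
    using span_is_subspace[of "set (cols A)"] Ac subspace_is_vs by simp
  have "subspace class_ring (span (set (cols (A * B)))) (span_vs (set (cols A)))"
    using nested_subspaces[OF _ _ sub] span_is_subspace Ac Cc by simp
  then have "vectorspace.dim class_ring (W.vs (span (set (cols (A * B))))) \<le> W.dim"
    using W.subspace_dim fin_dim_span_cols[OF A] fin_dim_span_cols[OF AB] by simp
  then show ?thesis using mat_rank_eq[OF A] mat_rank_eq[OF AB] by (simp add: rank_def)
qed

text \<open>Transposing a factorization \<open>A = X * Y\<close> through a space of dimension \<open>mat_rank A\<close> gives such a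
  factorization of the transpose.\<close>

lemma mat_rank_transpose_le:
  fixes A :: "real mat"
  shows "mat_rank A\<^sup>T \<le> mat_rank A"
proof -
  have A: "A \<in> carrier_mat (dim_row A) (dim_col A)" by simp
  interpret vec_space "TYPE(real)" "dim_col A" .
  obtain X Y where X: "X \<in> carrier_mat (dim_row A) (mat_rank A)"
    and Y: "Y \<in> carrier_mat (mat_rank A) (dim_col A)" and eq: "A = X * Y"
    using rank_factorization[OF A] by metis
  have "A\<^sup>T = Y\<^sup>T * X\<^sup>T" using eq transpose_mult[OF X Y] by simp
  then have "mat_rank A\<^sup>T \<le> mat_rank Y\<^sup>T"
    using mat_rank_mult_le_left[of "Y\<^sup>T" _ _ "X\<^sup>T"] X Y by auto
  also have "\<dots> \<le> mat_rank A" using rank_le_nc[of "Y\<^sup>T" "mat_rank A"] Y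
    by (simp add: mat_rank_eq[of _ "dim_col A" "mat_rank A"])
  finally show ?thesis .
qed

lemma mat_rank_transpose: "mat_rank A\<^sup>T = mat_rank A"
  using mat_rank_transpose_le[of A] mat_rank_transpose_le[of "A\<^sup>T"] by simp

lemma mat_rank_mult_le_right:
  fixes A B :: "real mat"
  assumes A: "A \<in> carrier_mat d c" and B: "B \<in> carrier_mat c e"
  shows "mat_rank (A * B) \<le> mat_rank B"
  using mat_rank_mult_le_left[of "B\<^sup>T" e c "A\<^sup>T" d] A B transpose_mult[OF A B]
  by (metis mat_rank_transpose transpose_carrier_mat)

lemma mat_rank_add_le:
  assumes "A \<in> carrier_mat d c" and "B \<in> carrier_mat d c"
  shows "mat_rank (A + B) \<le> mat_rank A + mat_rank B"
  using vec_space.rank_subadditive[OF assms] assms by (simp add: mat_rank_eq[of _ d c])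

section \<open>Orthogonal projection onto a column space\<close>

text \<open>If \<open>U\<^sup>T U v = 0\<close>, then the squared norm \<open>(U v) \<bullet> (U v)\<close> vanishes, so \<open>U v = 0\<close> and \<open>v = 0\<close>.\<close>

lemma gram_matrix_invertible:
  fixes U :: "real mat"
  assumes U: "U \<in> carrier_mat d r"
    and ker: "\<And>v. v \<in> carrier_vec r \<Longrightarrow> U *\<^sub>v v = 0\<^sub>v d \<Longrightarrow> v = 0\<^sub>v r"
  obtains J where "J \<in> carrier_mat r r" and "U\<^sup>T * U * J = 1\<^sub>m r"
proof -
  have G: "U\<^sup>T * U \<in> carrier_mat r r" using U by auto
  have "v = 0\<^sub>v r" if v: "v \<in> carrier_vec r" and "(U\<^sup>T * U) *\<^sub>v v = 0\<^sub>v r" for v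
  proof -
    have Uv: "U *\<^sub>v v \<in> carrier_vec d" using U v by auto
    have "U\<^sup>T *\<^sub>v (U *\<^sub>v v) = 0\<^sub>v r" using that U by simp
    then have "(U *\<^sub>v v) \<bullet> (U *\<^sub>v v) = 0"
      using transpose_vec_mult_scalar[OF U v Uv] v by simp
    then show ?thesis using real_scalar_prod_self_eq_0[OF Uv] ker[OF v] by simp
  qed
  then have "det (U\<^sup>T * U) \<noteq> 0" using det_0_iff_vec_prod_zero_field[OF G] by blast
  then have "U\<^sup>T * U \<in> Units (ring_mat TYPE(real) r ())" by (rule det_non_zero_imp_unit[OF G])
  then show thesis using that by (auto simp: Units_def ring_mat_def)
qed

text \<open>With \<open>U\<close> of trivial kernel spanning the column space of \<open>A\<close>, the projection of \<open>b\<close> is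
  \<open>U (U\<^sup>T U)\<^sup>-\<^sup>1 U\<^sup>T b\<close>, the solution of the normal equations.\<close>

lemma orthogonal_projection_exists:
  fixes A :: "real mat"
  assumes A: "A \<in> carrier_mat d c" and b: "b \<in> carrier_vec d"
  shows "\<exists>p \<in> vec_space.col_space d A. \<forall>y \<in> vec_space.col_space d A. (b - p) \<bullet> y = 0"
proof -
  let ?r = "mat_rank A"
  obtain U Y Z where U: "U \<in> carrier_mat d ?r" and Y: "Y \<in> carrier_mat ?r c"
    and Z: "Z \<in> carrier_mat c ?r" and AUY: "A = U * Y" and UAZ: "U = A * Z"
    and ker: "\<And>v. v \<in> carrier_vec ?r \<Longrightarrow> U *\<^sub>v v = 0\<^sub>v d \<Longrightarrow> v = 0\<^sub>v ?r"
    by (rule rank_factorization[OF A]) blast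
  obtain J where J: "J \<in> carrier_mat ?r ?r" and inv: "U\<^sup>T * U * J = 1\<^sub>m ?r"
    by (rule gram_matrix_invertible[OF U]) (use ker in blast)+
  define w where "w = J *\<^sub>v (U\<^sup>T *\<^sub>v b)"
  have w: "w \<in> carrier_vec ?r" using J U b by (auto simp: w_def)
  have p: "U *\<^sub>v w \<in> carrier_vec d" using U w by auto
  have "U\<^sup>T *\<^sub>v (U *\<^sub>v w) = (U\<^sup>T * U * J) *\<^sub>v (U\<^sup>T *\<^sub>v b)"
    unfolding w_def using U J b
    by (subst assoc_mult_mat_vec[of _ ?r ?r _ ?r], auto)
  then have normal_eq: "U\<^sup>T *\<^sub>v (U *\<^sub>v w) = U\<^sup>T *\<^sub>v b" using inv U b by auto
  have "U *\<^sub>v w = A *\<^sub>v (Z *\<^sub>v w)" unfolding UAZ using assoc_mult_mat_vec[OF A Z w] UAZ by simp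
  then have in_space: "U *\<^sub>v w \<in> vec_space.col_space d A"
    unfolding col_space_iff[OF A] using Z w by auto
  have "(b - U *\<^sub>v w) \<bullet> y = 0" if y: "y \<in> vec_space.col_space d A" for y
  proof -
    obtain x where x: "x \<in> carrier_vec c" "y = A *\<^sub>v x"
      using y unfolding col_space_iff[OF A] by blast
    then have yU: "y = U *\<^sub>v (Y *\<^sub>v x)" using AUY assoc_mult_mat_vec[OF U Y] by simp
    have Yx: "Y *\<^sub>v x \<in> carrier_vec ?r" using Y x by auto
    have "(b - U *\<^sub>v w) \<bullet> y = (U\<^sup>T *\<^sub>v (b - U *\<^sub>v w)) \<bullet> (Y *\<^sub>v x)"
      unfolding yU using transpose_vec_mult_scalar[OF U Yx] b p by simp
    also have "U\<^sup>T *\<^sub>v (b - U *\<^sub>v w) = U\<^sup>T *\<^sub>v b - U\<^sup>T *\<^sub>v (U *\<^sub>v w)"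
      by (rule mult_minus_distrib_mat_vec[of _ ?r d]) (use U b p in auto)
    also have "\<dots> = 0\<^sub>v ?r" unfolding normal_eq using U b by (auto intro!: eq_vecI)
    finally show ?thesis using Yx by simp
  qed
  then show ?thesis using in_space by blast
qed

text \<open>The definition of \<^const>\<open>orth_proj\<close> by a definite description is justified by uniqueness: the
  difference of two candidates lies in the column space and is orthogonal to it, hence to itself, so
  it is zero.\<close>

lemma orth_proj:
  fixes A :: "real mat"
  assumes A: "A \<in> carrier_mat d c" and b: "b \<in> carrier_vec d"
  shows "orth_proj A b \<in> vec_space.col_space d A"
    and "\<And>y. y \<in> vec_space.col_space d A \<Longrightarrow> (b - orth_proj A b) \<bullet> y = 0"
proof -
  let ?W = "vec_space.col_space d A"
  let ?Q = "\<lambda>p. p \<in> ?W \<and> (\<forall>y\<in>?W. (b - p) \<bullet> y = 0)"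
  have Wc: "p \<in> carrier_vec d" if "p \<in> ?W" for p using that col_space_iff[OF A] A by auto
  have uniq: "p = q" if "?Q p" "?Q q" for p q
  proof -
    have pq: "p \<in> carrier_vec d" "q \<in> carrier_vec d" using that Wc by auto
    obtain x z where "x \<in> carrier_vec c" "z \<in> carrier_vec c" "p = A *\<^sub>v x" "q = A *\<^sub>v z"
      using \<open>?Q p\<close> \<open>?Q q\<close> col_space_iff[OF A] by auto
    then have "p - q = A *\<^sub>v (x - z)" "x - z \<in> carrier_vec c"
      using mult_minus_distrib_mat_vec[OF A] by auto
    then have "p - q \<in> ?W" using col_space_iff[OF A] by auto
    then have "(b - q) \<bullet> (p - q) - (b - p) \<bullet> (p - q) = 0" using that by simp
    also have "(b - q) \<bullet> (p - q) - (b - p) \<bullet> (p - q) = ((b - q) - (b - p)) \<bullet> (p - q)"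
      by (rule minus_scalar_prod_distrib[of _ d, symmetric]) (use b pq in auto)
    also have "(b - q) - (b - p) = p - q" using b pq by (intro eq_vecI) auto
    finally have "p - q = 0\<^sub>v d" using real_scalar_prod_self_eq_0[of "p - q" d] pq by auto
    then have "(p - q) $ i = 0" if "i < d" for i using that by simp
    then show ?thesis using pq by (intro eq_vecI) auto
  qed
  have "\<exists>!p. ?Q p" using orthogonal_projection_exists[OF A b] uniq by blast
  then have "?Q (orth_proj A b)" unfolding orth_proj_def carrier_matD(1)[OF A] by (rule theI')
  then show "orth_proj A b \<in> ?W" and "\<And>y. y \<in> ?W \<Longrightarrow> (b - orth_proj A b) \<bullet> y = 0" by auto
qed

section \<open>Juxtaposed matrices\<close>

lemma hcat_carrier [simp]:
  "A \<in> carrier_mat m c \<Longrightarrow> B \<in> carrier_mat m k \<Longrightarrow> hcat A B \<in> carrier_mat m (c + k)"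
  by (rule carrier_matI) (simp_all add: hcat_def)

lemma hcat_index:
  assumes "A \<in> carrier_mat m c" and "B \<in> carrier_mat m k" and "i < m" and "j < c + k"
  shows "hcat A B $$ (i, j) = (if j < c then A $$ (i, j) else B $$ (i, j - c))"
  using assms by (simp add: hcat_def)

lemma hcat_mult_four_block:
  fixes A B :: "real mat"
  assumes "A \<in> carrier_mat m c" and "B \<in> carrier_mat m k"
    and "C \<in> carrier_mat c p" and "D \<in> carrier_mat c q"
    and "E \<in> carrier_mat k p" and "F \<in> carrier_mat k q"
  shows "hcat A B * four_block_mat C D E F = hcat (A * C + B * E) (A * D + B * F)"
  unfolding hcat_def using assms
  by (subst mult_four_block_mat[of _ m c _ k _ 0 _ _ p _ q]) auto

lemma mult_hcat:
  fixes A :: "real mat"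
  assumes A: "A \<in> carrier_mat m c" and "C \<in> carrier_mat c p" and "D \<in> carrier_mat c q"
  shows "A * hcat C D = hcat (A * C) (A * D)"
proof (rule eq_matI)
  fix i j assume "i < dim_row (hcat (A * C) (A * D))" "j < dim_col (hcat (A * C) (A * D))"
  then have ij: "i < m" "j < p + q" using assms by (auto simp: hcat_def)
  have "col (hcat C D) j = (if j < p then col C j else col D (j - p))"
    by (rule eq_vecI) (use assms ij in \<open>auto simp: hcat_def\<close>)
  then show "(A * hcat C D) $$ (i, j) = hcat (A * C) (A * D) $$ (i, j)"
    using assms ij by (auto simp: hcat_def)
qed (use assms in \<open>auto simp: hcat_def\<close>)

lemma transpose_hcat_mult_hcat:
  fixes C D E F :: "real mat"
  assumes "C \<in> carrier_mat m c" and "D \<in> carrier_mat m k"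
    and "E \<in> carrier_mat m p" and "F \<in> carrier_mat m q"
  shows "(hcat C D)\<^sup>T * hcat E F = four_block_mat (C\<^sup>T * E) (C\<^sup>T * F) (D\<^sup>T * E) (D\<^sup>T * F)"
  unfolding hcat_def using assms
  by (subst transpose_four_block_mat[of _ m c _ k _ 0], auto)
     (subst mult_four_block_mat[of _ c m _ 0 _ k _ _ p _ q], auto)

lemma hcat_mult_vec:
  fixes U V :: "real mat"
  assumes U: "U \<in> carrier_mat m r" and V: "V \<in> carrier_mat m s"
    and "u \<in> carrier_vec r" and "v \<in> carrier_vec s"
  shows "hcat U V *\<^sub>v (u @\<^sub>v v) = U *\<^sub>v u + V *\<^sub>v v"
  unfolding hcat_def using assms
  by (subst four_block_mat_mult_vec[of _ m r _ s _ 0]) (auto intro!: eq_vecI)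

section \<open>The rank of a juxtaposition\<close>

text \<open>For \<open>\<le>\<close>, \<open>[A  A X + Q] = A [I  X] + Q [0  I]\<close>. For \<open>\<ge>\<close>, let the columns of \<open>U\<close> and \<open>V\<close> be bases of
  the column spaces of \<open>A\<close> and \<open>Q\<close>. These spaces are orthogonal, so \<open>[U  V]\<close> has trivial kernel, and
  it is \<open>[A  A X + Q]\<close> times a block matrix.\<close>

lemma mat_rank_hcat_orthogonal:
  fixes A X Q :: "real mat"
  assumes A: "A \<in> carrier_mat m c" and X: "X \<in> carrier_mat c k" and Q: "Q \<in> carrier_mat m k"
    and orth: "Q\<^sup>T * A = 0\<^sub>m k c"
  shows "mat_rank (hcat A (A * X + Q)) = mat_rank A + mat_rank Q"
proof (rule antisym)
  let ?H = "hcat A (A * X + Q)"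
  have B: "A * X + Q \<in> carrier_mat m k" using A X Q by auto
  have H: "?H \<in> carrier_mat m (c + k)" using A B by auto
  have C1: "hcat (1\<^sub>m c) X \<in> carrier_mat c (c + k)" using X by auto
  have C2: "hcat (0\<^sub>m k c) (1\<^sub>m k) \<in> carrier_mat k (c + k)" by auto
  have "?H = A * hcat (1\<^sub>m c) X + Q * hcat (0\<^sub>m k c) (1\<^sub>m k)"
    unfolding mult_hcat[OF A one_carrier_mat X] mult_hcat[OF Q zero_carrier_mat one_carrier_mat]
    by (rule eq_matI) (use A X Q in \<open>auto simp: hcat_def\<close>)
  then have "mat_rank ?H \<le> mat_rank (A * hcat (1\<^sub>m c) X) + mat_rank (Q * hcat (0\<^sub>m k c) (1\<^sub>m k))"
    using mat_rank_add_le[OF mult_carrier_mat[OF A C1] mult_carrier_mat[OF Q C2]] by simp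
  also have "\<dots> \<le> mat_rank A + mat_rank Q"
    by (intro add_mono mat_rank_mult_le_left[OF A C1] mat_rank_mult_le_left[OF Q C2])
  finally show "mat_rank ?H \<le> mat_rank A + mat_rank Q" .

  let ?r = "mat_rank A" and ?s = "mat_rank Q"
  obtain U Z1 where U: "U \<in> carrier_mat m ?r" and Z1: "Z1 \<in> carrier_mat c ?r"
    and UA: "U = A * Z1"
    and kerU: "\<And>v. v \<in> carrier_vec ?r \<Longrightarrow> U *\<^sub>v v = 0\<^sub>v m \<Longrightarrow> v = 0\<^sub>v ?r"
    by (rule rank_factorization[OF A]) blast
  obtain V Z2 where V: "V \<in> carrier_mat m ?s" and Z2: "Z2 \<in> carrier_mat k ?s"
    and VQ: "V = Q * Z2"
    and kerV: "\<And>v. v \<in> carrier_vec ?s \<Longrightarrow> V *\<^sub>v v = 0\<^sub>v m \<Longrightarrow> v = 0\<^sub>v ?s"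
    by (rule rank_factorization[OF Q]) blast
  have UV: "hcat U V \<in> carrier_mat m (?r + ?s)" using U V by auto
  have "mat_rank (hcat U V) = ?r + ?s"
  proof (rule mat_rank_of_trivial_kernel[OF UV])
    fix w :: "real vec"
    assume w: "w \<in> carrier_vec (?r + ?s)" and zero: "hcat U V *\<^sub>v w = 0\<^sub>v m"
    define u v where "u = vec_first w ?r" and "v = vec_last w ?s"
    have uv: "u \<in> carrier_vec ?r" "v \<in> carrier_vec ?s" "w = u @\<^sub>v v"
      using w by (auto simp: u_def v_def)
    define a b where "a = U *\<^sub>v u" and "b = V *\<^sub>v v"
    have ab: "a \<in> carrier_vec m" "b \<in> carrier_vec m" using U V uv by (auto simp: a_def b_def)
    have sum: "a + b = 0\<^sub>v m" using zero hcat_mult_vec[OF U V uv(1,2)] uv by (simp add: a_def b_def)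
    have Zu: "Z1 *\<^sub>v u \<in> carrier_vec c" and Zv: "Z2 *\<^sub>v v \<in> carrier_vec k"
      using Z1 Z2 uv by auto
    have a: "a = A *\<^sub>v (Z1 *\<^sub>v u)" and b: "b = Q *\<^sub>v (Z2 *\<^sub>v v)"
      using assoc_mult_mat_vec[OF A Z1 uv(1)] assoc_mult_mat_vec[OF Q Z2 uv(2)]
      by (simp_all add: a_def b_def UA VQ)
    \<comment> \<open>Since \<open>a\<close> is orthogonal to \<open>b\<close>, multiplying \<open>a + b = 0\<close> by \<open>a\<close> gives \<open>a \<bullet> a = 0\<close>.\<close>
    have "a \<bullet> b = (Q\<^sup>T *\<^sub>v a) \<bullet> (Z2 *\<^sub>v v)"
      unfolding b using transpose_vec_mult_scalar[OF Q Zv ab(1)] by simp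
    also have "Q\<^sup>T *\<^sub>v a = (Q\<^sup>T * A) *\<^sub>v (Z1 *\<^sub>v u)"
      unfolding a by (rule assoc_mult_mat_vec[symmetric]) (use Q A Zu in auto)
    also have "\<dots> = 0\<^sub>v k" unfolding orth using Zu by (auto intro!: eq_vecI)
    finally have "a \<bullet> b = 0" using Zv by simp
    moreover have "a \<bullet> (a + b) = a \<bullet> a + a \<bullet> b" by (rule scalar_prod_add_distrib) (use ab in auto)
    ultimately have a0: "a = 0\<^sub>v m" using sum ab real_scalar_prod_self_eq_0[OF ab(1)] by simp
    then have b0: "b = 0\<^sub>v m" using sum ab by simp
    show "w = 0\<^sub>v (?r + ?s)"
      using kerU[OF uv(1)] kerV[OF uv(2)] a0 b0 uv(3) by (auto simp: a_def b_def intro!: eq_vecI)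
  qed
  \<comment> \<open>The block \<open>- (X * Z2)\<close> removes the part \<open>A * X * Z2\<close> of \<open>(A * X + Q) * Z2\<close> that lies in the
    column space of \<open>A\<close>.\<close>
  moreover have "hcat U V = ?H * four_block_mat Z1 (- (X * Z2)) (0\<^sub>m k ?r) Z2"
  proof -
    have XZ: "X * Z2 \<in> carrier_mat c ?s" using X Z2 by auto
    have "A * (- (X * Z2)) + (A * X + Q) * Z2 = V"
    proof -
      have AXZ: "A * (X * Z2) \<in> carrier_mat m ?s" using A XZ by auto
      have "(A * X + Q) * Z2 = A * X * Z2 + Q * Z2"
        by (rule add_mult_distrib_mat) (use A X Q Z2 in auto)
      also have "A * X * Z2 = A * (X * Z2)" by (rule assoc_mult_mat[OF A X Z2])
      finally have 1: "(A * X + Q) * Z2 = A * (X * Z2) + V" by (simp add: VQ)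
      have 2: "A * (- (X * Z2)) = - (A * (X * Z2))"
        by (rule uminus_mult_right_mat) (use A XZ in auto)
      show ?thesis
        unfolding 1 2 assoc_add_mat[OF uminus_carrier_mat[OF AXZ] AXZ V, symmetric]
        using AXZ V by simp
    qed
    moreover have "A * Z1 + (A * X + Q) * 0\<^sub>m k ?r = U"
      using right_mult_zero_mat[OF B] right_add_zero_mat[OF U] UA by simp
    ultimately show ?thesis
      using hcat_mult_four_block[OF A B Z1 _ zero_carrier_mat Z2, of "- (X * Z2)"] XZ by simp
  qed
  moreover have "four_block_mat Z1 (- (X * Z2)) (0\<^sub>m k ?r) Z2 \<in> carrier_mat (c + k) (?r + ?s)"
    using Z1 Z2 by auto
  ultimately show "?r + ?s \<le> mat_rank ?H" using mat_rank_mult_le_left[OF H] by metis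
qed

text \<open>Each projected column is a combination of columns of \<open>A\<close>; the coefficients of these combinations
  are the columns of \<open>X\<close>. The equation \<open>(perp_part A B)\<^sup>T * A = 0\<close> says that the two column spaces are
  orthogonal.\<close>

lemma projection_decomposition:
  fixes A B :: "real mat"
  assumes A: "A \<in> carrier_mat m c" and B: "B \<in> carrier_mat m k"
  obtains X where "X \<in> carrier_mat c k" and "B = A * X + perp_part A B"
    and "perp_part A B \<in> carrier_mat m k" and "(perp_part A B)\<^sup>T * A = 0\<^sub>m k c"
proof -
  let ?P = "proj_part A B" and ?Q = "perp_part A B"
  have P: "?P \<in> carrier_mat m k" using A B by (auto simp: proj_part_def)
  have Q: "?Q \<in> carrier_mat m k" using P B by (auto simp: perp_part_def)
  have Bj: "col B j \<in> carrier_vec m" for j using B by auto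
  have pc: "orth_proj A b \<in> carrier_vec m" if "b \<in> carrier_vec m" for b
    using orth_proj(1)[OF A that] col_space_iff[OF A] A by auto
  have colP: "col ?P j = orth_proj A (col B j)" if "j < k" for j
    unfolding proj_part_def using that A B pc[OF Bj] by (subst col_mat_of_cols) auto
  have colQ: "col ?Q j = col B j - orth_proj A (col B j)" if "j < k" for j
    unfolding colP[OF that, symmetric] perp_part_def
    using that B P by (intro eq_vecI) auto
  have "col ?P j \<in> vec_space.col_space m A" if "j < k" for j
    using orth_proj(1)[OF A Bj] colP[OF that] by simp
  then obtain X where X: "X \<in> carrier_mat c k" "?P = A * X"
    using mult_left_factor_if_cols[OF P A] by metis
  have "B = ?P + ?Q" unfolding perp_part_def by (rule eq_matI) (use P B in auto)
  moreover have "?Q\<^sup>T * A = 0\<^sub>m k c"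
  proof (rule eq_matI)
    fix i j assume ij: "i < dim_row (0\<^sub>m k c)" "j < dim_col (0\<^sub>m k c :: real mat)"
    have "col A j = A *\<^sub>v unit_vec c j" using ij A by (simp add: mult_mat_unit_vec)
    then have "col A j \<in> vec_space.col_space m A" using col_space_iff[OF A] by auto
    then show "(?Q\<^sup>T * A) $$ (i, j) = 0\<^sub>m k c $$ (i, j)"
      using ij Q A colQ orth_proj(2)[OF A Bj] by auto
  qed (use Q A in auto)
  ultimately show thesis using X Q that by metis
qed

lemma mat_rank_hcat:
  assumes A: "A \<in> carrier_mat m c" and B: "B \<in> carrier_mat m k"
  shows "mat_rank (hcat A B) = mat_rank A + mat_rank (perp_part A B)"
proof -
  obtain X where X: "X \<in> carrier_mat c k" "B = A * X + perp_part A B"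
    and Q: "perp_part A B \<in> carrier_mat m k" "(perp_part A B)\<^sup>T * A = 0\<^sub>m k c"
    by (rule projection_decomposition[OF A B])
  show ?thesis using mat_rank_hcat_orthogonal[OF A X(1) Q] X(2) by simp
qed

section \<open>A symmetric completion of small rank\<close>

text \<open>With \<open>E = [I  X]\<close>, \<open>F = [I  0]\<close> and \<open>G = [0  I]\<close>, the completed matrix is
  \<open>E\<^sup>T A E + F\<^sup>T Q G + (F\<^sup>T Q G)\<^sup>T\<close>, and each summand has at most the rank of its middle factor.\<close>

lemma mat_rank_symmetric_completion_le:
  fixes A X Q :: "real mat"
  assumes A: "A \<in> carrier_mat m m" and sym: "A\<^sup>T = A"
    and X: "X \<in> carrier_mat m k" and Q: "Q \<in> carrier_mat m k"
  shows "mat_rank (four_block_mat A (A * X + Q) (A * X + Q)\<^sup>T (X\<^sup>T * (A * X)))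
    \<le> mat_rank A + 2 * mat_rank Q"
proof -
  let ?E = "hcat (1\<^sub>m m) X" and ?F = "hcat (1\<^sub>m m) (0\<^sub>m m k)" and ?G = "hcat (0\<^sub>m k m) (1\<^sub>m k)"
  let ?S = "?E\<^sup>T * (A * ?E)" and ?T = "?F\<^sup>T * (Q * ?G)"
  have E: "?E \<in> carrier_mat m (m + k)" using X by auto
  have F: "?F \<in> carrier_mat m (m + k)" by auto
  have G: "?G \<in> carrier_mat k (m + k)" by auto
  have S: "?S \<in> carrier_mat (m + k) (m + k)" using E A by (metis mult_carrier_mat transpose_carrier_mat)
  have T: "?T \<in> carrier_mat (m + k) (m + k)" using F G Q by (metis mult_carrier_mat transpose_carrier_mat)
  have AX: "A * X \<in> carrier_mat m k" using A X by auto
  have "?S = four_block_mat A (A * X) (X\<^sup>T * A) (X\<^sup>T * (A * X))"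
    unfolding mult_hcat[OF A one_carrier_mat X] using A X AX
    by (subst transpose_hcat_mult_hcat[of _ m m _ k _ m _ k]) auto
  moreover have "?T = four_block_mat (0\<^sub>m m m) Q (0\<^sub>m k m) (0\<^sub>m k k)"
    unfolding mult_hcat[OF Q zero_carrier_mat one_carrier_mat] using Q
    by (subst transpose_hcat_mult_hcat[of _ m m _ k _ m _ k]) auto
  moreover have "(A * X + Q)\<^sup>T = X\<^sup>T * A + Q\<^sup>T"
    using transpose_add[OF AX Q] transpose_mult[OF A X] sym by simp
  ultimately have "four_block_mat A (A * X + Q) (A * X + Q)\<^sup>T (X\<^sup>T * (A * X)) = ?S + (?T + ?T\<^sup>T)"
    using A X Q AX
    by (simp, subst transpose_four_block_mat[of _ m m _ k _ k], auto)
  also have "mat_rank \<dots> \<le> mat_rank ?S + (mat_rank ?T + mat_rank ?T\<^sup>T)"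
    using mat_rank_add_le[OF S, of "?T + ?T\<^sup>T"] mat_rank_add_le[OF T, of "?T\<^sup>T"] T by fastforce
  also have "\<dots> \<le> mat_rank A + 2 * mat_rank Q"
  proof -
    have "mat_rank ?S \<le> mat_rank (A * ?E)"
      by (rule mat_rank_mult_le_right[of _ "m + k" m _ "m + k"]) (use E mult_carrier_mat[OF A E] in auto)
    also have "\<dots> \<le> mat_rank A" by (rule mat_rank_mult_le_left[OF A E])
    finally have 1: "mat_rank ?S \<le> mat_rank A" .
    have "mat_rank ?T \<le> mat_rank (Q * ?G)"
      by (rule mat_rank_mult_le_right[of _ "m + k" m _ "m + k"]) (use F mult_carrier_mat[OF Q G] in auto)
    also have "\<dots> \<le> mat_rank Q" by (rule mat_rank_mult_le_left[OF Q G])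
    finally show ?thesis using 1 by (simp only: mat_rank_transpose)
  qed
  finally show ?thesis .
qed

section \<open>Matrices of a probe graph\<close>

context
  fixes G :: "'v pair_pre_digraph" and N :: "'v set" and vs :: "'v list" and m k :: nat
  assumes probe: "probe_graph G N" and ord: "probe_ordering G N vs"
    and k: "card N = k" and m: "length vs - k = m"
begin

lemma length_eq: "length vs = m + k"
proof -
  have "card N \<le> length (drop (length vs - card N) vs)"
    using ord card_length unfolding probe_ordering_def by metis
  then show ?thesis using k m by simp
qed

lemma nonprobe_vertices: "m \<le> i \<Longrightarrow> i < m + k \<Longrightarrow> vs ! i \<in> N"
  using ord k m length_eq unfolding probe_ordering_def
  by (metis (no_types, lifting) in_set_conv_nth le_add_diff_inverse length_drop nth_drop
      add_diff_cancel_left' add_less_imp_less_left le_add1)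

lemma nonprobe_no_arc:
  "m \<le> i \<Longrightarrow> i < m + k \<Longrightarrow> m \<le> j \<Longrightarrow> j < m + k \<Longrightarrow> (vs ! i, vs ! j) \<notin> parcs G"
  using probe nonprobe_vertices unfolding probe_graph_def independent_set_def by blast

lemma arc_sym: "(u, v) \<in> parcs G \<longleftrightarrow> (v, u) \<in> parcs G"
proof -
  interpret pair_graph G using probe by (simp add: probe_graph_def)
  show ?thesis using sym_arcs by (auto simp: symmetric_def sym_def)
qed

text \<open>The pattern splits along the juxtaposition: off the diagonal of \<open>A\<close> it describes the arcs between
  probe vertices, and in \<open>B\<close> the arcs from probe to non-probe vertices.\<close>

lemma pattern_matrix_pair_iff:
  "pattern_matrix_pair (probe_pattern G N vs) A B \<longleftrightarrow>
    A \<in> carrier_mat m m \<and> A\<^sup>T = A \<and> B \<in> carrier_mat m k \<and>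
    (\<forall>i<m. \<forall>j<m. i \<noteq> j \<longrightarrow> (A $$ (i, j) \<noteq> 0 \<longleftrightarrow> (vs ! i, vs ! j) \<in> parcs G)) \<and>
    (\<forall>i<m. \<forall>j<k. B $$ (i, j) \<noteq> 0 \<longleftrightarrow> (vs ! i, vs ! (m + j)) \<in> parcs G)"
    (is "?L \<longleftrightarrow> ?R")
proof -
  have d: "dim_row (probe_pattern G N vs) = m" "dim_col (probe_pattern G N vs) = m + k"
    using k m length_eq by (simp_all add: probe_pattern_def)
  have entry: "matches (probe_pattern G N vs $$ (i, j)) x \<longleftrightarrow>
      i = j \<or> (x \<noteq> 0 \<longleftrightarrow> (vs ! i, vs ! j) \<in> parcs G)" if "i < m" "j < m + k" for i j x
    using that k m length_eq by (simp add: probe_pattern_def)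
  have "has_pattern (hcat A B) (probe_pattern G N vs) \<longleftrightarrow>
      (\<forall>i<m. \<forall>j<m+k. i \<noteq> j \<longrightarrow> (hcat A B $$ (i, j) \<noteq> 0 \<longleftrightarrow> (vs ! i, vs ! j) \<in> parcs G))"
    if "A \<in> carrier_mat m m" "B \<in> carrier_mat m k"
    using hcat_carrier[OF that] entry by (auto simp: has_pattern_def d)
  moreover have "(\<forall>j<m+k. P j) \<longleftrightarrow> (\<forall>j<m. P j) \<and> (\<forall>j<k. P (m + j))" for P
    by (metis add_less_cancel_left le_add_diff_inverse not_less trans_less_add1)
  ultimately show ?thesis
    unfolding pattern_matrix_pair_def d sym_mat_def
    by (auto simp: hcat_index)
qed

text \<open>Since \<open>N\<close> is independent, the matrix with lower right block \<open>0\<close> instead of \<open>C\<close> belongs to \<open>S(G)\<close>;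
  the block \<open>C\<close> is then the arbitrary symmetric summand that probe graphs allow.\<close>

lemma bordered_in_probe_mats:
  assumes AB: "pattern_matrix_pair (probe_pattern G N vs) A B"
    and C: "C \<in> carrier_mat k k" and symC: "C\<^sup>T = C"
  shows "four_block_mat A B B\<^sup>T C \<in> probe_mats G N vs"
proof -
  let ?A' = "four_block_mat A B B\<^sup>T (0\<^sub>m k k)"
  note AB = AB[unfolded pattern_matrix_pair_iff]
  have A: "A \<in> carrier_mat m m" and B: "B \<in> carrier_mat m k" using AB by auto
  have Aarc: "A $$ (i, j) \<noteq> 0 \<longleftrightarrow> (vs ! i, vs ! j) \<in> parcs G" if "i < m" "j < m" "i \<noteq> j" for i j
    using AB that by blast
  have Barc: "B $$ (i, j) \<noteq> 0 \<longleftrightarrow> (vs ! i, vs ! (m + j)) \<in> parcs G" if "i < m" "j < k" for i j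
    using AB that by blast
  have "?A'\<^sup>T = ?A'" using AB by (subst transpose_four_block_mat[of _ m m _ k _ k]) auto
  moreover have "?A' $$ (i, j) \<noteq> 0 \<longleftrightarrow> (vs ! i, vs ! j) \<in> parcs G"
    if ij: "i < m + k" "j < m + k" "i \<noteq> j" for i j
  proof -
    consider "i < m" "j < m" | "i < m" "m \<le> j" | "m \<le> i" "j < m" | "m \<le> i" "m \<le> j" by linarith
    then show ?thesis
    proof cases
      case 1
      then have "?A' $$ (i, j) = A $$ (i, j)" using A B by simp
      then show ?thesis using Aarc 1 ij by metis
    next
      case 2
      then obtain j' where j': "j = m + j'" "j' < k"
        using ij by (metis le_add_diff_inverse add_less_cancel_left)
      then have "?A' $$ (i, j) = B $$ (i, j')" using A B 2 by simp
      then show ?thesis using Barc 2 j' by metis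
    next
      case 3
      then obtain i' where i': "i = m + i'" "i' < k"
        using ij by (metis le_add_diff_inverse add_less_cancel_left)
      then have "?A' $$ (i, j) = B $$ (j, i')" using A B 3 by simp
      then show ?thesis using Barc 3 i' arc_sym by metis
    next
      case 4 then show ?thesis using A B ij nonprobe_no_arc by auto
    qed
  qed
  ultimately have A': "?A' \<in> graph_mats G vs"
    using A B by (auto simp: graph_mats_def sym_mat_def length_eq)
  have "four_block_mat A B B\<^sup>T C =
      ?A' + four_block_mat (0\<^sub>m m m) (0\<^sub>m m k) (0\<^sub>m k m) C"
    using A B C by (subst add_four_block_mat[of _ m m _ k _ k]) auto
  moreover have "sym_mat C" using C symC by (simp add: sym_mat_def)
  ultimately show ?thesis using A' C unfolding probe_mats_def Let_def k m by blast
qed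

text \<open>The arbitrary symmetric summand lives in the rows of the non-probe vertices, so the rows of the probe
  vertices keep the pattern. Selecting them is multiplication by \<open>[I  0]\<close> from the left.\<close>

lemma probe_rows:
  assumes "M \<in> probe_mats G N vs"
  obtains A B where "pattern_matrix_pair (probe_pattern G N vs) A B"
    and "mat_rank (hcat A B) \<le> mat_rank M"
proof -
  obtain A' C where A': "A' \<in> graph_mats G vs" and C: "C \<in> carrier_mat k k"
    and M: "M = A' + four_block_mat (0\<^sub>m m m) (0\<^sub>m m k) (0\<^sub>m k m) C"
    using assms k m unfolding probe_mats_def Let_def by auto
  have A'c: "A' \<in> carrier_mat (m + k) (m + k)" and A'sym: "A'\<^sup>T = A'"
    and A'arc: "\<And>i j. i < m + k \<Longrightarrow> j < m + k \<Longrightarrow> i \<noteq> j \<Longrightarrow>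
      A' $$ (i, j) \<noteq> 0 \<longleftrightarrow> (vs ! i, vs ! j) \<in> parcs G"
    using A' by (auto simp: graph_mats_def sym_mat_def length_eq)
  have Mc: "M \<in> carrier_mat (m + k) (m + k)" using A'c C M by auto
  define A where "A = mat m m (\<lambda>(i, j). A' $$ (i, j))"
  define B where "B = mat m k (\<lambda>(i, j). A' $$ (i, m + j))"
  have AB: "A \<in> carrier_mat m m" "B \<in> carrier_mat m k" by (auto simp: A_def B_def)
  have "A' $$ (j, i) = A' $$ (i, j)" if "i < m + k" "j < m + k" for i j
    using that A'c A'sym by (metis carrier_matD index_transpose_mat(1))
  then have "A\<^sup>T = A" by (intro eq_matI) (auto simp: A_def)
  then have pair: "pattern_matrix_pair (probe_pattern G N vs) A B"
    unfolding pattern_matrix_pair_iff using A'arc by (auto simp: A_def B_def)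
  let ?R = "hcat (1\<^sub>m m) (0\<^sub>m m k) :: real mat"
  have R: "?R \<in> carrier_mat m (m + k)" by auto
  have rowR: "row ?R i = unit_vec (m + k) i" if "i < m" for i
    by (rule eq_vecI) (use that in \<open>auto simp: hcat_def\<close>)
  have "hcat A B = ?R * M"
  proof (rule eq_matI)
    fix i j assume "i < dim_row (?R * M)" "j < dim_col (?R * M)"
    then have ij: "i < m" "j < m + k" using carrier_matD[OF R] Mc by auto
    have "(?R * M) $$ (i, j) = row ?R i \<bullet> col M j"
      using ij carrier_matD[OF R] Mc by (intro index_mult_mat(1)) auto
    also have "\<dots> = M $$ (i, j)"
      unfolding rowR[OF ij(1)] using ij Mc by (subst scalar_prod_left_unit) auto
    also have "\<dots> = A' $$ (i, j)" using ij A'c C by (auto simp: M)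
    also have "\<dots> = hcat A B $$ (i, j)"
      unfolding hcat_index[OF AB ij] using ij by (auto simp: A_def B_def)
    finally show "hcat A B $$ (i, j) = (?R * M) $$ (i, j)" by simp
  qed (use AB R Mc in \<open>auto simp: hcat_def\<close>)
  then show thesis using that pair mat_rank_mult_le_right[OF R Mc] by metis
qed

end

section \<open>Bounds on the minimum rank of a probe graph\<close>

theorem theorem2p3:
  fixes G :: "'v pair_pre_digraph" and N :: "'v set" and vs :: "'v list"
    and n k :: nat and P :: "pattern_entry mat" and A B :: "real mat"
  assumes "probe_graph G N"
    and "card (pverts G) = n" and "card N = k"
    and "probe_ordering G N vs"
    and "P = probe_pattern G N vs"
    and "A \<in> carrier_mat (n - k) (n - k)" and "B \<in> carrier_mat (n - k) k"
    and "realizes_min_rank P A B"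
  shows "mr_pattern P = mat_rank A + mat_rank (perp_part A B) \<and>
    mat_rank A + mat_rank (perp_part A B) \<le> mr_probe G N vs \<and>
    mr_probe G N vs \<le> mat_rank A + 2 * mat_rank (perp_part A B)"
proof -
  note A = assms(6) and B = assms(7)
  have m: "length vs - k = n - k"
    using assms(2,4) distinct_card unfolding probe_ordering_def by metis
  note graph = assms(1,4,3) m
  have AB: "pattern_matrix_pair (probe_pattern G N vs) A B"
    and "mat_rank (hcat A B) = mr_pattern P"
    using assms(5,8) by (auto simp: realizes_min_rank_def)
  then have eq: "mr_pattern P = mat_rank A + mat_rank (perp_part A B)"
    using mat_rank_hcat[OF A B] by simp

  obtain X where X: "X \<in> carrier_mat (n - k) k" and BX: "B = A * X + perp_part A B"
    and Q: "perp_part A B \<in> carrier_mat (n - k) k"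
    by (rule projection_decomposition[OF A B])
  have sym: "A\<^sup>T = A" using AB pattern_matrix_pair_iff[OF graph] by simp
  let ?C = "X\<^sup>T * (A * X)"
  have AX: "A * X \<in> carrier_mat (n - k) k" using A X by auto
  have C: "?C \<in> carrier_mat k k" using AX X by auto
  have symC: "?C\<^sup>T = ?C"
    using transpose_mult[of "X\<^sup>T" k "n - k" "A * X" k] transpose_mult[OF A X] sym X AX A
    by (simp add: assoc_mult_mat[of _ k "n - k" _ "n - k" _ k])
  let ?M = "four_block_mat A B B\<^sup>T ?C"
  have M: "?M \<in> probe_mats G N vs" by (rule bordered_in_probe_mats[OF graph AB C symC])
  have "mr_probe G N vs \<le> mat_rank ?M" unfolding mr_probe_def by (rule Least_le) (use M in blast)
  also have "\<dots> \<le> mat_rank A + 2 * mat_rank (perp_part A B)"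
    using mat_rank_symmetric_completion_le[OF A sym X Q] unfolding BX[symmetric] .
  finally have upper: "mr_probe G N vs \<le> mat_rank A + 2 * mat_rank (perp_part A B)" .

  \<comment> \<open>Since \<open>?M\<close> is a matrix of the probe graph, the minimum defining \<open>mr_probe\<close> is attained.\<close>
  have "\<exists>M0\<in>probe_mats G N vs. mat_rank M0 = mr_probe G N vs"
    unfolding mr_probe_def by (rule LeastI_ex) (use M in blast)
  then obtain M0 where "M0 \<in> probe_mats G N vs" and M0: "mat_rank M0 = mr_probe G N vs" by blast
  then obtain A0 B0 where "pattern_matrix_pair (probe_pattern G N vs) A0 B0"
    and le: "mat_rank (hcat A0 B0) \<le> mat_rank M0"
    using probe_rows[OF graph] by metis
  then have "mr_pattern P \<le> mat_rank (hcat A0 B0)"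
    unfolding mr_pattern_def assms(5) by (intro Least_le) blast
  then show ?thesis using eq upper le M0 by simp
qed

end
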